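(* Let $k \geq 1$ be an integer. For all graphs $G_1, G_2$, $$\alpha_k(G_1 \times G_2) \geq \alpha_k(G_1) \cdot \alpha_k(G_2).$$
   Context: Graphs are finite, simple and undirected. For a graph $G$, $\delta_G(u,v)$ is the length of a shortest path between vertices $u$ and $v$ in $G$ (equal to $\infty$ if there is none). A set $S \subseteq V(G)$ is $k$-independent if $\delta_G(u,v) > k$ for all distinct $u,v \in S$; $\alpha_k(G)$ denotes the maximum size of a $k$-independent set in $G$. The tensor product $G_1 \times G_2$ has vertex set $V(G_1)\times V(G_2)$, and $(u_1,u_2),(v_1,v_2)$ are adjacent if and only if $(u_1,v_1)\in E(G_1)$ and $(u_2,v_2)\in E(G_2)$. *)

theory Defs
  imports "Graph_Theory.Graph_Theory"
begin

text \<open>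
  Finite simple undirected graphs are the symmetric loop-free finite digraphs \<^locale>\<open>pair_graph\<close>;
  an undirected edge \<open>uv\<close> is the pair of arcs \<open>(u, v)\<close>, \<open>(v, u)\<close>. The null graph is allowed.
\<close>

text \<open>The infimum over the empty set is \<open>\<infinity>\<close>, which covers vertices not joined by a path.\<close>

definition graph_dist :: "'a pair_pre_digraph \<Rightarrow> 'a \<Rightarrow> 'a \<Rightarrow> enat" where
  "graph_dist G u v = (INF p \<in> {p. pre_digraph.apath (with_proj G) u p v}. enat (length p))"

definition k_independent :: "nat \<Rightarrow> 'a pair_pre_digraph \<Rightarrow> 'a set \<Rightarrow> bool" where
  "k_independent k G S \<longleftrightarrow>
     S \<subseteq> pverts G \<and> (\<forall>u\<in>S. \<forall>v\<in>S. u \<noteq> v \<longrightarrow> graph_dist G u v > enat k)"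

definition k_independence_number :: "nat \<Rightarrow> 'a pair_pre_digraph \<Rightarrow> nat" where
  "k_independence_number k G = Max {card S | S. k_independent k G S}"

definition tensor_product ::
  "'a pair_pre_digraph \<Rightarrow> 'b pair_pre_digraph \<Rightarrow> ('a \<times> 'b) pair_pre_digraph" where
  "tensor_product G H =
     \<lparr> pverts = pverts G \<times> pverts H,
       parcs = {((u1, u2), (v1, v2)) | u1 u2 v1 v2. (u1, v1) \<in> parcs G \<and> (u2, v2) \<in> parcs H} \<rparr>"

lemma pair_graph_tensor_product:
  assumes "pair_graph G" and "pair_graph H"
  shows "pair_graph (tensor_product G H)"
proof -
  interpret G: pair_graph G by fact
  interpret H: pair_graph H by fact
  let ?P = "tensor_product G H"
  have sub: "parcs ?P \<subseteq> (pverts G \<times> pverts H) \<times> (pverts G \<times> pverts H)"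
    using G.wellformed' H.wellformed' by (auto simp: tensor_product_def)
  have "finite (parcs ?P)"
    using finite_subset[OF sub] G.pair_finite_verts H.pair_finite_verts by blast
  moreover have "symmetric ?P"
    using G.pair_sym_arcs H.pair_sym_arcs
    by (fastforce simp: symmetric_def tensor_product_def sym_def)
  ultimately show ?thesis
    using sub G.pair_finite_verts H.pair_finite_verts
    by unfold_locales (auto simp: tensor_product_def dest: G.pair_no_loops G.wellformed' H.wellformed')
qed

lemma finite_card_k_independent:
  assumes "pair_graph G"
  shows "finite {card S | S. k_independent k G S}" and "{card S | S. k_independent k G S} \<noteq> {}"
proof -
  interpret G: pair_graph G by fact
  have "{card S | S. k_independent k G S} \<subseteq> card ` Pow (pverts G)"
    by (auto simp: k_independent_def)
  then show "finite {card S | S. k_independent k G S}"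
    by (rule finite_subset) (simp add: G.pair_finite_verts)
  have "k_independent k G {}" by (simp add: k_independent_def)
  then show "{card S | S. k_independent k G S} \<noteq> {}" by blast
qed

text \<open>\<open>wf_digraph.\<mu>\<close> minimises over walks instead of paths.\<close>

lemma graph_dist_eq_mu:
  assumes "pair_graph G"
  shows "ereal_of_enat (graph_dist G u v) = wf_digraph.\<mu> (with_proj G) (\<lambda>_. 1) u v"
proof -
  interpret G: pair_graph G by fact
  have cost: "G.awalk_cost (\<lambda>_. 1) p = real (length p)" for p :: "('a \<times> 'a) list"
    by (induct p) auto
  show ?thesis
  proof (cases "{p. G.apath u p v} = {}")
    case True
    then have "{p. G.awalk u p v} = {}" using G.apath_awalk_to_apath by blast
    with True show ?thesis
      unfolding graph_dist_def G.\<mu>_def by (simp add: top_ereal_def top_enat_def)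
  next
    case False
    then have "graph_dist G u v \<in> (\<lambda>p. enat (length p)) ` {p. G.apath u p v}"
      unfolding graph_dist_def by (metis (no_types, lifting) Inf_enat_def LeastI_ex empty_is_image equals0I)
    then obtain p where p: "G.apath u p v" "graph_dist G u v = enat (length p)" by auto
    have min: "length p \<le> length q" if "G.awalk u q v" for q
    proof -
      have "graph_dist G u v \<le> enat (length (G.awalk_to_apath q))"
        unfolding graph_dist_def using G.apath_awalk_to_apath[OF that] by (auto intro: INF_lower)
      moreover have "length (G.awalk_to_apath q) \<le> length q"
        using that
      proof (induct rule: G.awalk_to_apath_induct)
        case (path p) then show ?case by (subst G.awalk_to_apath.simps) auto
      next
        case (decomp p q r s)
        then show ?case by (auto simp: G.step_awalk_to_apath elim!: G.awalk_cyc_decompE)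
      qed
      ultimately show ?thesis using p by simp
    qed
    have "G.\<mu> (\<lambda>_. 1) u v = ereal (real (length p))"
      unfolding G.\<mu>_def cost
      using p min G.awalkI_apath by (intro INF_eqI) auto
    then show ?thesis using p by simp
  qed
qed

end

theory Submission
  imports Defs
begin

text \<open>
  The two projections of the tensor product are graph homomorphisms, and homomorphisms do not
  increase distances. Two distinct vertices of \<open>S \<times> T\<close> differ in some coordinate, so they are
  at least as far apart as two distinct vertices of \<open>S\<close> or of \<open>T\<close>.
\<close>

text \<open>\<open>graph_dist\<close> ranges over paths only, but it agrees with
  \<open>\<mu>\<close>, which ranges over all walks. This bound serves for walks that may repeat
  vertices.\<close>

lemma graph_dist_le_length_awalk:
  assumes "pair_graph G" and "pre_digraph.awalk (with_proj G) u p v"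
  shows "graph_dist G u v \<le> enat (length p)"
proof -
  interpret G: pair_graph G by fact
  \<comment> \<open>Unit arc costs turn the cost of a walk into its length; the inequality for
    \<open>\<mu>\<close> is then pulled back from \<open>ereal\<close> to
    \<open>enat\<close>.\<close>
  have "G.awalk_cost (\<lambda>_. 1) q = real (length q)" for q :: "('a \<times> 'a) list"
    by (induct q) auto
  then have "ereal_of_enat (graph_dist G u v) \<le> ereal_of_enat (enat (length p))"
    using G.min_cost_le_walk_cost[OF assms(2), of "\<lambda>_. 1"]
    by (simp add: graph_dist_eq_mu[OF assms(1)])
  then show ?thesis by (simp only: ereal_of_enat_le_iff)
qed

text \<open>The image of a path under a homomorphism has the same length but may revisit vertices,
  so it is treated as a walk.\<close>

lemma graph_dist_hom_le:
  assumes "pair_graph G" and "pair_graph H"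
    and verts: "f ` pverts G \<subseteq> pverts H"
    and arcs: "map_prod f f ` parcs G \<subseteq> parcs H"
  shows "graph_dist H (f u) (f v) \<le> graph_dist G u v"
proof -
  interpret G: pair_graph G by fact
  interpret H: pair_graph H by fact
  have cas: "H.cas (f x) (map (map_prod f f) p) (f y)" if "G.cas x p y" for x p y
    using that by (induct p arbitrary: x) auto
  have "graph_dist H (f u) (f v) \<le> enat (length p)" if "G.apath u p v" for p
  proof -
    from that have "G.awalk u p v" by (rule G.awalkI_apath)
    then have "H.awalk (f u) (map (map_prod f f) p) (f v)"
      using verts arcs cas unfolding G.awalk_def H.awalk_def by fastforce
    from graph_dist_le_length_awalk[OF assms(2) this] show ?thesis by simp
  qed
  \<comment> \<open>If no path joins \<open>u\<close> and \<open>v\<close>, the infimum is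
    \<open>\<infinity>\<close> and the bound is trivial.\<close>
  then show ?thesis
    unfolding graph_dist_def[of G] by (auto intro: INF_greatest)
qed

lemma graph_dist_tensor_product_ge:
  assumes "pair_graph G" and "pair_graph H"
  shows "graph_dist G (fst x) (fst y) \<le> graph_dist (tensor_product G H) x y"
    and "graph_dist H (snd x) (snd y) \<le> graph_dist (tensor_product G H) x y"
  \<comment> \<open>Unification sets \<open>f\<close> to \<open>fst\<close> and \<open>snd\<close>;
    what remains is that each projection preserves vertices and arcs.\<close>
  by (intro graph_dist_hom_le assms pair_graph_tensor_product;
      force simp: tensor_product_def)+

lemma k_independent_Times:
  assumes "pair_graph G" and "pair_graph H"
    and "k_independent k G S" and "k_independent k H T"
  shows "k_independent k (tensor_product G H) (S \<times> T)"
  unfolding k_independent_def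
proof (intro conjI ballI impI)
  show "S \<times> T \<subseteq> pverts (tensor_product G H)"
    using assms(3,4) by (auto simp: k_independent_def tensor_product_def)
next
  fix x y assume "x \<in> S \<times> T" "y \<in> S \<times> T" "x \<noteq> y"
  \<comment> \<open>Hence a disjunction: a coordinate in which \<open>x\<close> and \<open>y\<close>
    agree is at distance 0 and bounds nothing.\<close>
  then have "enat k < graph_dist G (fst x) (fst y) \<or> enat k < graph_dist H (snd x) (snd y)"
    using assms(3,4) unfolding k_independent_def by (metis mem_Times_iff prod_eqI)
  then show "enat k < graph_dist (tensor_product G H) x y"
    using graph_dist_tensor_product_ge[OF assms(1,2)] by (meson less_le_trans)
qed

text \<open>The set of sizes is finite and, thanks to the empty set, nonempty, so its
  \<open>Max\<close> is a member.\<close>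

lemma k_independence_number_attained:
  assumes "pair_graph G"
  obtains S where "k_independent k G S" and "card S = k_independence_number k G"
  using Max_in[OF finite_card_k_independent[OF assms, of k]]
  unfolding k_independence_number_def by force

lemma card_le_k_independence_number:
  assumes "pair_graph G" and "k_independent k G S"
  shows "card S \<le> k_independence_number k G"
  unfolding k_independence_number_def
  using finite_card_k_independent(1)[OF assms(1)] assms(2) by (auto intro: Max_ge)

theorem theorem4p3:
  fixes G1 :: "'a pair_pre_digraph" and G2 :: "'b pair_pre_digraph" and k :: nat
  assumes "k \<ge> 1" and "pair_graph G1" and "pair_graph G2"
  shows "k_independence_number k (tensor_product G1 G2)
           \<ge> k_independence_number k G1 * k_independence_number k G2"
proof -
  obtain S where S: "k_independent k G1 S" "card S = k_independence_number k G1"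
    using k_independence_number_attained[OF assms(2)] .
  obtain T where T: "k_independent k G2 T" "card T = k_independence_number k G2"
    using k_independence_number_attained[OF assms(3)] .
  have "card (S \<times> T) \<le> k_independence_number k (tensor_product G1 G2)"
    using assms(2,3) S(1) T(1)
    by (intro card_le_k_independence_number pair_graph_tensor_product k_independent_Times)
  then show ?thesis by (simp add: card_cartesian_product S(2) T(2))
qed

end
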